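(* Let $n\ge2$ and let $(S_1,\dots,S_{n-1},P)$ be a $\Gamma_n$-contraction on a Hilbert space $\mathcal H$. Then: (1) $\overline{\mathrm{Ran}}(I-P)$ and $\mathrm{Ker}(I-P)$ reduce $S_1,\dots,S_{n-1}$; (2) the restriction of $(S_1,\dots,S_{n-1},P)$ to $\mathrm{Ker}(I-P)$ is a $\Gamma_n$-identity; (3) the restriction of $(S_1,\dots,S_{n-1},P)$ to $\overline{\mathrm{Ran}}(I-P)$ is a completely non-identity $\Gamma_n$-contraction.
   Context: All operators are bounded linear operators on complex Hilbert spaces. A closed subspace reduces $T$ if it is invariant under $T$ and $T^*$. A compact set $K\subset\mathbb C^n$ is a spectral set for a commuting $n$-tuple $\underline T$ if the Taylor joint spectrum of $\underline T$ lies in $K$ and $\|f(\underline T)\|\le\sup_{K}|f|$ for every rational function $f$ with poles off $K$. The closed symmetrized polydisc is $\Gamma_n=\pi_n(\overline{\mathbb D}^n)$, where $\pi_n(z_1,\dots,z_n)=(\sum_i z_i,\sum_{i<j}z_iz_j,\dots,\prod_i z_i)$. A $\Gamma_n$-contraction is a commuting $n$-tuple $(S_1,\dots,S_{n-1},P)$ having $\Gamma_n$ as a spectral set (then $P$ is a contraction). It is a known fact that for a contraction $P$ on $\mathcal H$, $\mathcal H=\mathrm{Ker}(I-P)\oplus\overline{\mathrm{Ran}}(I-P)$ orthogonally, and both summands reduce $P$. A $\Gamma_n$-contraction $(S_1,\dots,S_{n-1},P)$ on a Hilbert space $\mathcal K$ is a $\Gamma_n$-identity if $P=I_{\mathcal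 K}$; it is a completely non-identity $\Gamma_n$-contraction if there is no nontrivial proper subspace of $\mathcal K$ that reduces $P$ and on which $P$ is equal to the identity operator. *)

theory Defs
  imports "HOL-Analysis.Analysis" "HOL-Library.Poly_Mapping"
begin

section \<open>Complex Hilbert spaces, closed subspaces and operators\<close>

text \<open>The inner product is linear in the first argument.\<close>

class chilbert_space = banach +
  fixes scaleC :: "complex \<Rightarrow> 'a \<Rightarrow> 'a" (infixr "*\<^sub>C" 75)
    and cinner :: "'a \<Rightarrow> 'a \<Rightarrow> complex"
  assumes scaleC_add_right: "c *\<^sub>C (x + y) = c *\<^sub>C x + c *\<^sub>C y"
    and scaleC_add_left: "(c + d) *\<^sub>C x = c *\<^sub>C x + d *\<^sub>C x"
    and scaleC_scaleC: "c *\<^sub>C (d *\<^sub>C x) = (c * d) *\<^sub>C x"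
    and scaleC_of_real: "complex_of_real r *\<^sub>C x = r *\<^sub>R x"
    and cinner_commute: "cinner x y = cnj (cinner y x)"
    and cinner_add_left: "cinner (x + y) z = cinner x z + cinner y z"
    and cinner_scaleC_left: "cinner (c *\<^sub>C x) y = c * cinner x y"
    and cinner_self: "cinner x x = complex_of_real ((norm x)\<^sup>2)"

instantiation complex :: chilbert_space
begin

definition scaleC_complex :: "complex \<Rightarrow> complex \<Rightarrow> complex"
  where "scaleC_complex c x = c * x"

definition cinner_complex :: "complex \<Rightarrow> complex \<Rightarrow> complex"
  where "cinner_complex x y = x * cnj y"

instance
proof
  fix c d x y z :: complex and r :: real
  show "c *\<^sub>C (x + y) = c *\<^sub>C x + c *\<^sub>C y" "(c + d) *\<^sub>C x = c *\<^sub>C x + d *\<^sub>C x"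
    "c *\<^sub>C (d *\<^sub>C x) = (c * d) *\<^sub>C x"
    by (simp_all add: scaleC_complex_def algebra_simps)
  show "complex_of_real r *\<^sub>C x = r *\<^sub>R x"
    by (simp add: scaleC_complex_def scaleR_conv_of_real)
  show "cinner x y = cnj (cinner y x)" "cinner (x + y) z = cinner x z + cinner y z"
    "cinner (c *\<^sub>C x) y = c * cinner x y"
    by (simp_all add: scaleC_complex_def cinner_complex_def algebra_simps)
  show "cinner x x = complex_of_real ((norm x)\<^sup>2)"
    unfolding cinner_complex_def by (rule complex_norm_square [symmetric])
qed

end

definition closed_csubspace :: "'a::chilbert_space set \<Rightarrow> bool" where
  "closed_csubspace M \<longleftrightarrow> 0 \<in> M \<and> (\<forall>x\<in>M. \<forall>y\<in>M. x + y \<in> M) \<and>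
     (\<forall>c. \<forall>x\<in>M. c *\<^sub>C x \<in> M) \<and> closed M"

text \<open>A closed subspace \<open>M\<close> is a Hilbert space in its own right. The notions below are
  relative to such an \<open>M\<close> and only depend on the values of the operators on \<open>M\<close>, so the restriction
  of an operator to an invariant subspace \<open>M\<close> is the same function viewed on \<open>M\<close>, and
  \<open>M = UNIV\<close> is the case of operators on the whole space.\<close>

definition bounded_op_on :: "'a::chilbert_space set \<Rightarrow> ('a \<Rightarrow> 'a) \<Rightarrow> bool" where
  "bounded_op_on M A \<longleftrightarrow> A ` M \<subseteq> M \<and>
     (\<forall>x\<in>M. \<forall>y\<in>M. A (x + y) = A x + A y) \<and>
     (\<forall>c. \<forall>x\<in>M. A (c *\<^sub>C x) = c *\<^sub>C A x) \<and>
     (\<exists>B. \<forall>x\<in>M. norm (A x) \<le> B * norm x)"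

text \<open>The Hilbert space adjoint of \<open>A\<close> as an operator on \<open>M\<close>.\<close>

definition adjoint_on :: "'a::chilbert_space set \<Rightarrow> ('a \<Rightarrow> 'a) \<Rightarrow> 'a \<Rightarrow> 'a" where
  "adjoint_on M A y = (THE w. w \<in> M \<and> (\<forall>x\<in>M. cinner (A x) y = cinner x w))"

text \<open>\<open>L\<close> reduces the operator \<open>A\<close> on \<open>M\<close>.\<close>

definition reduces_on :: "'a::chilbert_space set \<Rightarrow> 'a set \<Rightarrow> ('a \<Rightarrow> 'a) \<Rightarrow> bool" where
  "reduces_on M L A \<longleftrightarrow> closed_csubspace L \<and> L \<subseteq> M \<and> A ` L \<subseteq> L \<and> adjoint_on M A ` L \<subseteq> L"

text \<open>All \<open>n\<close>-tuples are indexed by \<open>{1..n}\<close>.\<close>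

definition commuting_tuple_on ::
    "'a::chilbert_space set \<Rightarrow> nat \<Rightarrow> (nat \<Rightarrow> 'a \<Rightarrow> 'a) \<Rightarrow> bool" where
  "commuting_tuple_on M n T \<longleftrightarrow> (\<forall>i\<in>{1..n}. bounded_op_on M (T i)) \<and>
     (\<forall>i\<in>{1..n}. \<forall>j\<in>{1..n}. \<forall>x\<in>M. T i (T j x) = T j (T i x))"


section \<open>The Taylor joint spectrum\<close>

text \<open>The space \<open>\<complex>\<^sup>n\<close>, with its usual topology inherited from the product topology on
  \<open>nat \<Rightarrow> complex\<close>.\<close>

definition cspace :: "nat \<Rightarrow> (nat \<Rightarrow> complex) set" where
  "cspace n = {z. \<forall>i. i \<notin> {1..n} \<longrightarrow> z i = 0}"

text \<open>\<open>M \<otimes> \<Lambda>(\<complex>\<^sup>n)\<close>: the vector \<open>w J\<close> is the coefficient of the basis form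
  \<open>e_{j1} \<and> \<dots> \<and> e_{jp}\<close> with \<open>J = {j1 < \<dots> < jp}\<close>.\<close>

definition koszul_space :: "'a::chilbert_space set \<Rightarrow> nat \<Rightarrow> (nat set \<Rightarrow> 'a) set" where
  "koszul_space M n = {w. \<forall>J. if J \<subseteq> {1..n} then w J \<in> M else w J = 0}"

text \<open>The Koszul differential \<open>\<Sum>i. T i \<otimes> (e_i \<and> _)\<close>; the sign arises from sorting
  \<open>e_i \<and> e_{J - {i}}\<close>.\<close>

definition koszul_diff ::
    "nat \<Rightarrow> (nat \<Rightarrow> 'a::chilbert_space \<Rightarrow> 'a) \<Rightarrow> (nat set \<Rightarrow> 'a) \<Rightarrow> nat set \<Rightarrow> 'a" where
  "koszul_diff n T w J =
     (if J \<subseteq> {1..n} then \<Sum>i\<in>J. (-1) ^ card {j\<in>J. j < i} *\<^sub>R T i (w (J - {i})) else 0)"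

text \<open>Exactness is stated for the direct sum of all degrees, which is the same as exactness in
  every degree because the differential is homogeneous.\<close>

definition taylor_nonsingular_on ::
    "'a::chilbert_space set \<Rightarrow> nat \<Rightarrow> (nat \<Rightarrow> 'a \<Rightarrow> 'a) \<Rightarrow> bool" where
  "taylor_nonsingular_on M n T \<longleftrightarrow>
     {w \<in> koszul_space M n. koszul_diff n T w = (\<lambda>_. 0)} = koszul_diff n T ` koszul_space M n"

definition taylor_spectrum_on ::
    "'a::chilbert_space set \<Rightarrow> nat \<Rightarrow> (nat \<Rightarrow> 'a \<Rightarrow> 'a) \<Rightarrow> (nat \<Rightarrow> complex) set" where
  "taylor_spectrum_on M n T =
     {l \<in> cspace n. \<not> taylor_nonsingular_on M n (\<lambda>i x. T i x - l i *\<^sub>C x)}"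


section \<open>Rational functions and spectral sets\<close>

text \<open>Polynomials are finitely supported maps from monomials (exponent vectors) to coefficients.\<close>

type_synonym cpoly = "(nat \<Rightarrow>\<^sub>0 nat) \<Rightarrow>\<^sub>0 complex"

definition cpolys :: "nat \<Rightarrow> cpoly set" where
  "cpolys n = {p. \<forall>m\<in>Poly_Mapping.keys p. Poly_Mapping.keys m \<subseteq> {1..n}}"

definition poly_eval :: "nat \<Rightarrow> cpoly \<Rightarrow> (nat \<Rightarrow> complex) \<Rightarrow> complex" where
  "poly_eval n p z =
     (\<Sum>m\<in>Poly_Mapping.keys p. Poly_Mapping.lookup p m * (\<Prod>i\<in>{1..n}. z i ^ Poly_Mapping.lookup m i))"

definition monom_op ::
    "nat \<Rightarrow> (nat \<Rightarrow>\<^sub>0 nat) \<Rightarrow> (nat \<Rightarrow> 'a \<Rightarrow> 'a) \<Rightarrow> 'a \<Rightarrow> 'a" where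
  "monom_op n m T = foldr (\<lambda>i A. (T i ^^ Poly_Mapping.lookup m i) \<circ> A) [1..<Suc n] id"

definition poly_op ::
    "nat \<Rightarrow> cpoly \<Rightarrow> (nat \<Rightarrow> 'a::chilbert_space \<Rightarrow> 'a) \<Rightarrow> 'a \<Rightarrow> 'a" where
  "poly_op n p T x =
     (\<Sum>m\<in>Poly_Mapping.keys p. Poly_Mapping.lookup p m *\<^sub>C monom_op n m T x)"

text \<open>The rational function \<open>f = p / q\<close> is applied to the tuple as \<open>f(T) = p(T) q(T)\<^sup>-\<^sup>1\<close>.
  Invertibility of \<open>q(T)\<close> is part of the assertion that \<open>f(T)\<close> makes sense; it is
  automatic by the spectral mapping theorem when the Taylor spectrum lies in \<open>K\<close>.
  The last line says that the operator norm of \<open>f(T)\<close> is at most the supremum of \<open>f\<close> on \<open>K\<close>.\<close>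

definition spectral_set_on ::
    "'a::chilbert_space set \<Rightarrow> nat \<Rightarrow> (nat \<Rightarrow> 'a \<Rightarrow> 'a) \<Rightarrow> (nat \<Rightarrow> complex) set \<Rightarrow> bool" where
  "spectral_set_on M n T K \<longleftrightarrow>
     K \<subseteq> cspace n \<and> compact K \<and>
     taylor_spectrum_on M n T \<subseteq> K \<and>
     (\<forall>p\<in>cpolys n. \<forall>q\<in>cpolys n. (\<forall>z\<in>K. poly_eval n q z \<noteq> 0) \<longrightarrow>
        bij_betw (poly_op n q T) M M \<and>
        (\<forall>x\<in>M. norm (poly_op n p T (inv_into M (poly_op n q T) x))
            \<le> (SUP z\<in>K. cmod (poly_eval n p z / poly_eval n q z)) * norm x))"


section \<open>The symmetrized polydisc and \<open>\<Gamma>\<^sub>n\<close>-contractions\<close>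

definition sym_map :: "nat \<Rightarrow> (nat \<Rightarrow> complex) \<Rightarrow> nat \<Rightarrow> complex" where
  "sym_map n z k =
     (if k \<in> {1..n} then \<Sum>J | J \<subseteq> {1..n} \<and> card J = k. \<Prod>j\<in>J. z j else 0)"

definition Gamma_set :: "nat \<Rightarrow> (nat \<Rightarrow> complex) set" where
  "Gamma_set n = sym_map n ` {z \<in> cspace n. \<forall>i\<in>{1..n}. cmod (z i) \<le> 1}"

text \<open>The tuple \<open>(S 1, \<dots>, S (n - 1), P)\<close> is \<open>S(n := P)\<close>; other values of \<open>S\<close> are irrelevant.\<close>

definition gamma_contraction_on ::
    "'a::chilbert_space set \<Rightarrow> nat \<Rightarrow> (nat \<Rightarrow> 'a \<Rightarrow> 'a) \<Rightarrow> ('a \<Rightarrow> 'a) \<Rightarrow> bool" where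
  "gamma_contraction_on M n S P \<longleftrightarrow>
     closed_csubspace M \<and> commuting_tuple_on M n (S(n := P)) \<and>
     spectral_set_on M n (S(n := P)) (Gamma_set n)"

definition gamma_identity_on ::
    "'a::chilbert_space set \<Rightarrow> nat \<Rightarrow> (nat \<Rightarrow> 'a \<Rightarrow> 'a) \<Rightarrow> ('a \<Rightarrow> 'a) \<Rightarrow> bool" where
  "gamma_identity_on M n S P \<longleftrightarrow> gamma_contraction_on M n S P \<and> (\<forall>x\<in>M. P x = x)"

definition cni_gamma_contraction_on ::
    "'a::chilbert_space set \<Rightarrow> nat \<Rightarrow> (nat \<Rightarrow> 'a \<Rightarrow> 'a) \<Rightarrow> ('a \<Rightarrow> 'a) \<Rightarrow> bool" where
  "cni_gamma_contraction_on M n S P \<longleftrightarrow>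
     gamma_contraction_on M n S P \<and>
     \<not> (\<exists>L. L \<noteq> {0} \<and> L \<noteq> M \<and> reduces_on M L P \<and> (\<forall>x\<in>L. P x = x))"

end

theory Submission
  imports Defs
begin

text \<open>
  Everything follows from the orthogonal decomposition of the space into \<open>Ker (I - P)\<close> and
  \<open>closure (Ran (I - P))\<close>, which the mean ergodic theorem attaches to a contraction \<open>P\<close>.

  That \<open>P\<close> is a contraction is the spectral set inequality for the coordinate function
  \<open>z\<^sub>n\<close>, which is a product of \<open>n\<close> numbers of the closed disc on \<open>\<Gamma>\<^sub>n\<close>. For a contraction,
  \<open>Ker (I - P)\<close> is exactly the orthogonal complement of \<open>Ran (I - P)\<close>
  (\<open>contraction_fixed_space\<close>).

  Each \<open>S\<^sub>i\<close> commutes with \<open>P\<close>, so it leaves both the kernel and the range of \<open>I - P\<close>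
  invariant. These are orthogonal complements of each other (up to a closure), and an operator that
  leaves a closed subspace and its complement invariant is reduced by both: this gives (1). It also
  means that the orthogonal projection onto either summand commutes with the whole tuple. Such a
  projection splits the Koszul complex and commutes with all polynomials in the tuple, so that
  exactness, invertibility of the denominators and the norm inequality all pass to the summand
  (\<open>gamma_contraction_restrict\<close>): the restrictions are \<open>\<Gamma>\<^sub>n\<close>-contractions. Finally,
  \<open>P\<close> is the identity on \<open>Ker (I - P)\<close> by definition, while a subspace of
  \<open>closure (Ran (I - P))\<close> on which \<open>P\<close> is the identity is orthogonal to itself, hence zero.
\<close>

section \<open>Inner products and orthogonal projections\<close>

lemma cinner_add_right: "cinner x (y + z) = cinner x y + cinner x (z::'a::chilbert_space)"
  by (metis cinner_commute cinner_add_left complex_cnj_add)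

lemma cinner_scaleC_right: "cinner x (c *\<^sub>C y) = cnj c * cinner x (y::'a::chilbert_space)"
  by (metis cinner_commute cinner_scaleC_left complex_cnj_mult)

lemma scaleC_minus_one: "(-1) *\<^sub>C x = - (x::'a::chilbert_space)"
  using scaleC_of_real[of "-1" x] by simp

lemma cinner_minus_left: "cinner (- x) y = - cinner (x::'a::chilbert_space) y"
  using cinner_scaleC_left[of "-1" x y] by (simp add: scaleC_minus_one)

lemma cinner_minus_right: "cinner x (- y) = - cinner x (y::'a::chilbert_space)"
  using cinner_scaleC_right[of x "-1" y] by (simp add: scaleC_minus_one)

lemma cinner_diff_left: "cinner (x - y) z = cinner x z - cinner y (z::'a::chilbert_space)"
  using cinner_add_left[of x "- y" z] by (simp add: cinner_minus_left)

lemma cinner_diff_right: "cinner x (y - z) = cinner x y - cinner x (z::'a::chilbert_space)"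
  using cinner_add_right[of x y "- z"] by (simp add: cinner_minus_right)

lemma cinner_zero_left [simp]: "cinner 0 (y::'a::chilbert_space) = 0"
  using cinner_diff_left[of 0 0 y] by simp

lemma cinner_zero_right [simp]: "cinner (y::'a::chilbert_space) 0 = 0"
  using cinner_diff_right[of y 0 0] by simp

lemma cinner_eq_0_commute: "cinner x y = 0 \<longleftrightarrow> cinner y (x::'a::chilbert_space) = 0"
  by (subst cinner_commute) simp

lemma cinner_self_eq_0: "cinner x x = 0 \<longleftrightarrow> x = (0::'a::chilbert_space)"
  by (simp add: cinner_self)

lemma norm_add_square:
  "(norm (x + y))\<^sup>2 = (norm x)\<^sup>2 + 2 * Re (cinner x y) + (norm (y::'a::chilbert_space))\<^sup>2"
proof -
  have "cinner (x + y) (x + y) = cinner x x + cinner x y + (cnj (cinner x y) + cinner y y)"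
    using cinner_commute[of y x] by (simp add: cinner_add_left cinner_add_right)
  then have "Re (cinner (x + y) (x + y)) = Re (cinner x x) + 2 * Re (cinner x y) + Re (cinner y y)"
    by simp
  then show ?thesis by (simp add: cinner_self)
qed

lemma norm_diff_square:
  "(norm (x - y))\<^sup>2 = (norm x)\<^sup>2 - 2 * Re (cinner x y) + (norm (y::'a::chilbert_space))\<^sup>2"
  using norm_add_square[of x "- y"] by (simp add: cinner_minus_right)

lemma norm_scaleC: "norm (c *\<^sub>C x) = cmod c * norm (x::'a::chilbert_space)"
proof -
  have "cinner (c *\<^sub>C x) (c *\<^sub>C x) = c * cnj c * cinner x x"
    by (simp add: cinner_scaleC_left cinner_scaleC_right)
  then have "complex_of_real ((norm (c *\<^sub>C x))\<^sup>2) = of_real ((cmod c * norm x)\<^sup>2)"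
    by (simp add: cinner_self power_mult_distrib) (simp flip: complex_norm_square)
  then have "(norm (c *\<^sub>C x))\<^sup>2 = (cmod c * norm x)\<^sup>2"
    using of_real_eq_iff by blast
  then show ?thesis by (simp add: power2_eq_iff_nonneg)
qed

lemma Cauchy_Schwarz_cinner: "cmod (cinner x y) \<le> norm x * norm (y::'a::chilbert_space)"
proof (cases "y = 0")
  case False
  define c where "c = cinner x y / of_real ((norm y)\<^sup>2)"
  have N: "(norm y)\<^sup>2 > 0" using False by simp
  have "Re (cinner x (c *\<^sub>C y)) = (cmod (cinner x y))\<^sup>2 / (norm y)\<^sup>2"
  proof -
    have "cinner x (c *\<^sub>C y) = of_real ((cmod (cinner x y))\<^sup>2 / (norm y)\<^sup>2)"
      by (simp add: cinner_scaleC_right c_def complex_norm_square mult.commute del: of_real_power)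
    then show ?thesis by simp
  qed
  moreover have "(norm (c *\<^sub>C y))\<^sup>2 = (cmod (cinner x y))\<^sup>2 / (norm y)\<^sup>2"
    using N by (simp add: norm_scaleC c_def norm_divide power_mult_distrib power_divide
        power2_eq_square norm_mult field_simps)
  ultimately have "0 \<le> (norm x)\<^sup>2 - (cmod (cinner x y))\<^sup>2 / (norm y)\<^sup>2"
    using norm_diff_square[of x "c *\<^sub>C y"] zero_le_power2[of "norm (x - c *\<^sub>C y)"] by simp
  then have "(cmod (cinner x y))\<^sup>2 \<le> (norm x * norm y)\<^sup>2"
    using N by (simp add: field_simps power_mult_distrib)
  then show ?thesis by (rule power2_le_imp_le) simp
qed simp

lemma bounded_linear_cinner_left: "bounded_linear (\<lambda>x. cinner x (y::'a::chilbert_space))"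
proof (rule bounded_linear_intro)
  fix r :: real and x x' :: 'a
  show "cinner (x + x') y = cinner x y + cinner x' y" by (rule cinner_add_left)
  show "cinner (r *\<^sub>R x) y = r *\<^sub>R cinner x y"
    using cinner_scaleC_left[of "of_real r" x y]
    by (simp add: scaleC_of_real scaleR_conv_of_real)
  show "norm (cinner x y) \<le> norm x * norm y" by (rule Cauchy_Schwarz_cinner)
qed

text \<open>The first order condition at a minimum: both the best approximation property and the
  contractivity of an operator give an inequality whose linear part dominates for small \<open>t\<close>.\<close>

lemma first_order_condition:
  fixes c :: complex and K :: real
  assumes "\<And>t. 2 * Re (cnj t * c) \<le> (cmod t)\<^sup>2 * K"
  shows "c = 0"
proof (rule ccontr)
  assume "c \<noteq> 0"
  \<comment> \<open>At \<open>t = e c\<close> the linear term is \<open>2 e\<close> and the quadratic one \<open>e\<^sup>2 K\<close>, both times the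
    square of the modulus of \<open>c\<close>; so any \<open>e > 0\<close> with \<open>e K < 2\<close> is a contradiction.\<close>
  define e where "e = 1 / (\<bar>K\<bar> + 1)"
  have e: "e > 0" "e * K < 2"
    by (auto simp: e_def field_simps)
  have cc: "cnj c * c = of_real ((cmod c)\<^sup>2)"
    by (simp only: complex_norm_square mult.commute)
  have "cnj (of_real e * c) * c = of_real (e * (cmod c)\<^sup>2)"
    using cc by (simp add: mult.assoc)
  then have "2 * (e * (cmod c)\<^sup>2) \<le> (cmod (of_real e * c))\<^sup>2 * K"
    using assms[of "of_real e * c"] by (metis Re_complex_of_real)
  also have "\<dots> = (e * (cmod c)\<^sup>2) * (e * K)"
    using e by (simp add: norm_mult power_mult_distrib power2_eq_square)
  finally have "(e * (cmod c)\<^sup>2) * 2 \<le> (e * (cmod c)\<^sup>2) * (e * K)"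
    by simp
  then have "2 \<le> e * K"
    using e \<open>c \<noteq> 0\<close> by (subst (asm) mult_le_cancel_left_pos) simp_all
  with e show False by simp
qed

lemma closed_csubspace_0: "closed_csubspace M \<Longrightarrow> 0 \<in> M"
  and closed_csubspace_add: "closed_csubspace M \<Longrightarrow> x \<in> M \<Longrightarrow> y \<in> M \<Longrightarrow> x + y \<in> M"
  and closed_csubspace_scaleC: "closed_csubspace M \<Longrightarrow> x \<in> M \<Longrightarrow> c *\<^sub>C x \<in> M"
  and closed_csubspace_closed: "closed_csubspace M \<Longrightarrow> closed M"
  by (simp_all add: closed_csubspace_def)

lemma closed_csubspace_diff: "closed_csubspace M \<Longrightarrow> x \<in> M \<Longrightarrow> y \<in> M \<Longrightarrow> x - y \<in> M"
  using closed_csubspace_add[of M x "(-1) *\<^sub>C y"] closed_csubspace_scaleC[of M y "-1"]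
  by (simp add: scaleC_minus_one)

definition ortho_compl :: "'a::chilbert_space set \<Rightarrow> 'a set" where
  "ortho_compl M = {x. \<forall>y\<in>M. cinner x y = 0}"

text \<open>By the parallelogram law, the points of \<open>M\<close> that nearly minimise the distance to \<open>x\<close> form
  nested closed sets whose diameters tend to \<open>0\<close>; their common point is the foot of the
  perpendicular.\<close>

lemma orthogonal_projection_exists:
  fixes x :: "'a::chilbert_space"
  assumes M: "closed_csubspace M"
  obtains m where "m \<in> M" "x - m \<in> ortho_compl M"
proof -
  define D where "D = (INF m\<in>M. (norm (x - m))\<^sup>2)"
  define F where "F k = {m\<in>M. (norm (x - m))\<^sup>2 \<le> D + inverse (real (Suc k))}" for k
  have ne: "M \<noteq> {}" using closed_csubspace_0[OF M] by auto
  have bdd: "bdd_below ((\<lambda>m. (norm (x - m))\<^sup>2) ` M)"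
    by (rule bdd_belowI[of _ 0]) auto
  have D_le: "D \<le> (norm (x - m))\<^sup>2" if "m \<in> M" for m
    unfolding D_def using bdd that by (rule cINF_lower)
  have F_closed: "closed (F k)" for k
  proof -
    have "F k = M \<inter> {m. (norm (x - m))\<^sup>2 \<le> D + inverse (real (Suc k))}"
      by (auto simp: F_def)
    moreover have "closed {m. (norm (x - m))\<^sup>2 \<le> D + inverse (real (Suc k))}"
      by (intro closed_Collect_le continuous_intros)
    ultimately show ?thesis using closed_csubspace_closed[OF M] by auto
  qed
  have F_ne: "F k \<noteq> {}" for k
  proof -
    have "D < D + inverse (real (Suc k))" by simp
    then obtain m where "m \<in> M" "(norm (x - m))\<^sup>2 < D + inverse (real (Suc k))"
      unfolding D_def using cINF_less_iff[OF ne bdd] by blast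
    then show ?thesis by (auto simp: F_def intro!: exI[of _ m])
  qed
  have F_mono: "F k \<subseteq> F j" if "j \<le> k" for j k
  proof -
    have "inverse (real (Suc k)) \<le> inverse (real (Suc j))" using that by (simp add: field_simps)
    then have "D + inverse (real (Suc k)) \<le> D + inverse (real (Suc j))" by simp
    then show ?thesis unfolding F_def by (blast intro: order_trans)
  qed
  have diam: "(norm (u - v))\<^sup>2 \<le> 4 * inverse (real (Suc k))" if "u \<in> F k" "v \<in> F k" for u v k
  proof -
    define a where "a = x - u"
    define b where "b = x - v"
    define m where "m = of_real (1/2) *\<^sub>C (u + v)"
    have mM: "m \<in> M"
      using that M unfolding m_def F_def
      by (intro closed_csubspace_scaleC closed_csubspace_add) auto
    have "a + b = 2 *\<^sub>R (x - m)"
      unfolding a_def b_def m_def scaleC_of_real by (simp add: scaleR_2 algebra_simps)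
    then have "(norm (a + b))\<^sup>2 = 4 * (norm (x - m))\<^sup>2"
      by (simp add: power_mult_distrib)
    then have "(norm (a + b))\<^sup>2 \<ge> 4 * D" using D_le[OF mM] by simp
    moreover have "(norm (a - b))\<^sup>2 + (norm (a + b))\<^sup>2 = 2 * (norm a)\<^sup>2 + 2 * (norm b)\<^sup>2"
      by (simp add: norm_add_square norm_diff_square)
    moreover have "norm (a - b) = norm (u - v)"
      by (simp add: a_def b_def norm_minus_commute)
    ultimately show ?thesis using that by (simp add: F_def a_def b_def)
  qed
  have "\<exists>k. \<forall>u\<in>F k. \<forall>v\<in>F k. dist u v < e" if "e > 0" for e
  proof -
    from \<open>e > 0\<close> have "e\<^sup>2 / 4 > 0" by simp
    then obtain k where k: "inverse (real (Suc k)) < e\<^sup>2 / 4" using reals_Archimedean by blast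
    have "dist u v < e" if uv: "u \<in> F k" "v \<in> F k" for u v
    proof -
      have "(norm (u - v))\<^sup>2 < e\<^sup>2" using diam[OF uv] k by simp
      then show ?thesis using \<open>e > 0\<close> by (simp add: dist_norm power2_less_imp_less)
    qed
    then show ?thesis by blast
  qed
  then obtain m where "\<Inter>(range F) = {m}"
    using decreasing_closed_nest_sing[of F] F_closed F_ne F_mono by metis
  then have mF: "m \<in> F k" for k by blast
  then have mM: "m \<in> M" by (simp add: F_def)
  have min: "(norm (x - m))\<^sup>2 \<le> D"
  proof (rule field_le_epsilon)
    fix e :: real assume "e > 0"
    then obtain k where "inverse (real (Suc k)) < e" using reals_Archimedean by blast
    then show "(norm (x - m))\<^sup>2 \<le> D + e" using mF[of k] by (simp add: F_def)
  qed
  have "cinner (x - m) y = 0" if y: "y \<in> M" for y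
  proof (rule first_order_condition)
    fix t
    have "m + t *\<^sub>C y \<in> M"
      using M mM y by (intro closed_csubspace_add closed_csubspace_scaleC)
    from D_le[OF this] min have "(norm (x - m))\<^sup>2 \<le> (norm ((x - m) - t *\<^sub>C y))\<^sup>2"
      unfolding diff_diff_eq by (rule order_trans[rotated])
    then show "2 * Re (cnj t * cinner (x - m) y) \<le> (cmod t)\<^sup>2 * (norm y)\<^sup>2"
      by (simp add: norm_diff_square cinner_scaleC_right norm_scaleC power_mult_distrib)
  qed
  with mM show ?thesis by (intro that) (auto simp: ortho_compl_def)
qed

lemma ortho_compl_Int: "x \<in> M \<Longrightarrow> x \<in> ortho_compl M \<Longrightarrow> x = 0"
  using cinner_self_eq_0 by (auto simp: ortho_compl_def)

lemma closed_csubspace_ortho_compl: "closed_csubspace (ortho_compl M)"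
proof -
  have "ortho_compl M = (\<Inter>y\<in>M. {x. cinner x y = 0})"
    by (auto simp: ortho_compl_def)
  moreover have "closed {x. cinner x y = 0}" for y :: 'a
    by (intro closed_Collect_eq linear_continuous_on bounded_linear_cinner_left continuous_intros)
  ultimately have "closed (ortho_compl M)" by auto
  then show ?thesis
    by (auto simp: closed_csubspace_def ortho_compl_def cinner_add_left cinner_scaleC_left)
qed

lemma ortho_compl_ortho_compl:
  assumes M: "closed_csubspace M"
  shows "ortho_compl (ortho_compl M) = M"
proof
  show "M \<subseteq> ortho_compl (ortho_compl M)"
    unfolding ortho_compl_def using cinner_eq_0_commute by blast
  show "ortho_compl (ortho_compl M) \<subseteq> M"
  proof
    fix x assume x: "x \<in> ortho_compl (ortho_compl M)"
    obtain m where m: "m \<in> M" "x - m \<in> ortho_compl M"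
      using orthogonal_projection_exists[OF M] .
    have "x - m \<in> ortho_compl (ortho_compl M)"
      using x m(1) \<open>M \<subseteq> ortho_compl (ortho_compl M)\<close>
      by (intro closed_csubspace_diff closed_csubspace_ortho_compl) auto
    then have "x - m = 0" using m(2) by (intro ortho_compl_Int)
    with m(1) show "x \<in> M" by simp
  qed
qed

definition ortho_proj :: "'a::chilbert_space set \<Rightarrow> 'a \<Rightarrow> 'a" where
  "ortho_proj M x = (THE m. m \<in> M \<and> x - m \<in> ortho_compl M)"

lemma ortho_proj_eqI:
  assumes M: "closed_csubspace M" and m: "m \<in> M" "x - m \<in> ortho_compl M"
  shows "ortho_proj M x = m"
  unfolding ortho_proj_def
proof (rule the_equality)
  fix m' assume m': "m' \<in> M \<and> x - m' \<in> ortho_compl M"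
  have "(x - m) - (x - m') \<in> ortho_compl M"
    using m m' closed_csubspace_diff[OF closed_csubspace_ortho_compl] by blast
  then have "m' - m = 0"
    using closed_csubspace_diff[OF M, of m' m] m m' by (intro ortho_compl_Int[of _ M]) auto
  then show "m' = m" by simp
qed (use m in auto)

lemma
  assumes M: "closed_csubspace M"
  shows ortho_proj_in: "ortho_proj M x \<in> M"
    and ortho_proj_diff: "x - ortho_proj M x \<in> ortho_compl M"
proof -
  obtain m where "m \<in> M" "x - m \<in> ortho_compl M"
    using orthogonal_projection_exists[OF M] .
  then show "ortho_proj M x \<in> M" "x - ortho_proj M x \<in> ortho_compl M"
    using ortho_proj_eqI[OF M] by auto
qed

lemma ortho_proj_id:
  assumes "closed_csubspace M" "x \<in> M"
  shows "ortho_proj M x = x"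
  using assms closed_csubspace_0[OF closed_csubspace_ortho_compl]
  by (intro ortho_proj_eqI) auto

lemma ortho_proj_add:
  assumes M: "closed_csubspace M"
  shows "ortho_proj M (x + y) = ortho_proj M x + ortho_proj M y"
proof (rule ortho_proj_eqI[OF M])
  show "ortho_proj M x + ortho_proj M y \<in> M"
    using M by (intro closed_csubspace_add ortho_proj_in)
  have "(x - ortho_proj M x) + (y - ortho_proj M y) \<in> ortho_compl M"
    using M by (intro closed_csubspace_add closed_csubspace_ortho_compl ortho_proj_diff)
  then show "x + y - (ortho_proj M x + ortho_proj M y) \<in> ortho_compl M"
    by (simp add: algebra_simps)
qed

section \<open>Bounded operators, adjoints and reducing subspaces\<close>

lemma bounded_op_add: "bounded_op_on UNIV A \<Longrightarrow> A (x + y) = A x + A y"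
  and bounded_op_scaleC: "bounded_op_on UNIV A \<Longrightarrow> A (c *\<^sub>C x) = c *\<^sub>C A x"
  by (simp_all add: bounded_op_on_def)

lemma bounded_op_diff: "bounded_op_on UNIV A \<Longrightarrow> A (x - y) = A x - A y"
  using bounded_op_add[of A "x - y" y] by (simp add: algebra_simps)

lemma bounded_op_0: "bounded_op_on UNIV A \<Longrightarrow> A 0 = 0"
  using bounded_op_diff[of A 0 0] by simp

lemma bounded_op_scaleC_map: "bounded_op_on UNIV (\<lambda>x::'a::chilbert_space. c *\<^sub>C x)"
proof -
  have "norm (c *\<^sub>C x) \<le> cmod c * norm x" for x :: 'a by (simp add: norm_scaleC)
  moreover have "c *\<^sub>C d *\<^sub>C x = d *\<^sub>C c *\<^sub>C x" for d and x :: 'a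
    by (simp only: scaleC_scaleC mult.commute)
  ultimately show ?thesis unfolding bounded_op_on_def by (blast intro: scaleC_add_right)
qed

lemma bounded_op_bounded_linear:
  assumes A: "bounded_op_on UNIV A"
  shows "bounded_linear A"
proof -
  obtain B where B: "norm (A x) \<le> norm x * B" for x
    using A by (auto simp: bounded_op_on_def mult.commute)
  show ?thesis
  proof (rule bounded_linear_intro)
    fix r x
    show "A (r *\<^sub>R x) = r *\<^sub>R A x"
      using bounded_op_scaleC[OF A, of "of_real r" x] by (simp add: scaleC_of_real)
  qed (use B bounded_op_add[OF A] in auto)
qed

text \<open>The Riesz representation of \<open>f\<close>: a vector \<open>u\<close> with \<open>f u \<noteq> 0\<close> orthogonal to the kernel
  of \<open>f\<close> spans the complement of the kernel, so \<open>f\<close> is a multiple of the inner product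
  with \<open>u\<close>.\<close>

lemma Riesz_representation:
  fixes f :: "'a::chilbert_space \<Rightarrow> complex"
  assumes f: "bounded_linear f" and scale: "\<And>c x. f (c *\<^sub>C x) = c * f x"
  obtains w where "\<And>x. f x = cinner x w"
proof (cases "\<forall>x. f x = 0")
  case True
  then show ?thesis by (intro that[of 0]) simp
next
  case False
  then obtain v where v: "f v \<noteq> 0" by blast
  interpret f: bounded_linear f by (rule f)
  have "closed {x. f x = 0}"
    by (intro closed_Collect_eq linear_continuous_on f continuous_intros)
  then have ker: "closed_csubspace {x. f x = 0}"
    by (simp add: closed_csubspace_def f.add scale f.zero)
  obtain m where m: "f m = 0" "v - m \<in> ortho_compl {x. f x = 0}"
    using orthogonal_projection_exists[OF ker] by blast
  define u where "u = v - m"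
  have fu: "f u \<noteq> 0" using v m(1) by (simp add: u_def f.diff)
  then have u0: "u \<noteq> 0" using f.zero by auto
  have "f x = cinner x (cnj (f u / cinner u u) *\<^sub>C u)" for x
  proof -
    have "f (x - (f x / f u) *\<^sub>C u) = 0"
      using fu by (simp add: f.diff scale)
    then have "cinner u (x - (f x / f u) *\<^sub>C u) = 0"
      using m(2) unfolding u_def[symmetric] ortho_compl_def by blast
    then have "cinner (x - (f x / f u) *\<^sub>C u) u = 0"
      using cinner_eq_0_commute by blast
    then have "cinner x u = (f x / f u) * cinner u u"
      by (simp add: cinner_diff_left cinner_scaleC_left)
    then show ?thesis
      using fu u0 by (simp add: cinner_scaleC_right cinner_self_eq_0)
  qed
  then show ?thesis by (rule that)
qed

lemma cinner_adjoint:
  assumes A: "bounded_op_on UNIV A"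
  shows "cinner (A x) y = cinner x (adjoint_on UNIV A y)"
proof -
  have "bounded_linear (\<lambda>x. cinner (A x) y)"
    by (rule bounded_linear_compose[OF bounded_linear_cinner_left bounded_op_bounded_linear[OF A]])
  then obtain w where w: "\<And>x. cinner (A x) y = cinner x w"
    using Riesz_representation[of "\<lambda>x. cinner (A x) y"]
    by (metis bounded_op_scaleC[OF A] cinner_scaleC_left)
  have "adjoint_on UNIV A y = w"
    unfolding adjoint_on_def
  proof (rule the_equality)
    fix w' assume "w' \<in> UNIV \<and> (\<forall>x\<in>UNIV. cinner (A x) y = cinner x w')"
    then have "cinner (w' - w) w' = cinner (w' - w) w" using w by (metis UNIV_I)
    then have "cinner (w' - w) (w' - w) = 0" by (simp add: cinner_diff_right)
    then show "w' = w" by (simp add: cinner_self_eq_0)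
  qed (use w in auto)
  with w show ?thesis by simp
qed

text \<open>Invariance of the complement under \<open>A\<close> is invariance of \<open>L\<close> under the adjoint.\<close>

lemma reduces_if_complement_invariant:
  assumes A: "bounded_op_on UNIV A" and L: "closed_csubspace L"
    and inv: "A ` L \<subseteq> L" "A ` ortho_compl L \<subseteq> ortho_compl L"
  shows "reduces_on UNIV L A"
proof -
  have "adjoint_on UNIV A y \<in> L" if y: "y \<in> L" for y
  proof -
    have "cinner (adjoint_on UNIV A y) x = 0" if x: "x \<in> ortho_compl L" for x
    proof -
      have "A x \<in> ortho_compl L" using inv(2) x by blast
      then have "cinner (A x) y = 0" using y by (simp add: ortho_compl_def)
      then have "cinner x (adjoint_on UNIV A y) = 0" using cinner_adjoint[OF A] by simp
      then show ?thesis using cinner_eq_0_commute by blast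
    qed
    then have "adjoint_on UNIV A y \<in> ortho_compl (ortho_compl L)"
      by (simp add: ortho_compl_def[of "ortho_compl L"])
    then show ?thesis by (simp add: ortho_compl_ortho_compl[OF L])
  qed
  with L inv(1) show ?thesis unfolding reduces_on_def by blast
qed

lemma ortho_proj_commute:
  assumes A: "bounded_op_on UNIV A" and M: "closed_csubspace M"
    and inv: "A ` M \<subseteq> M" "A ` ortho_compl M \<subseteq> ortho_compl M"
  shows "ortho_proj M (A x) = A (ortho_proj M x)"
proof (rule ortho_proj_eqI[OF M])
  show "A (ortho_proj M x) \<in> M" using inv(1) ortho_proj_in[OF M] by blast
  show "A x - A (ortho_proj M x) \<in> ortho_compl M"
    unfolding bounded_op_diff[OF A, symmetric] using inv(2) ortho_proj_diff[OF M] by blast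
qed

lemma ortho_proj_scaleC:
  assumes M: "closed_csubspace M"
  shows "ortho_proj M (c *\<^sub>C x) = c *\<^sub>C ortho_proj M (x::'a::chilbert_space)"
  by (rule ortho_proj_commute[OF bounded_op_scaleC_map M])
    (auto intro: closed_csubspace_scaleC M closed_csubspace_ortho_compl)

section \<open>Restriction to a direct summand of the space\<close>

text \<open>The projection \<open>Q\<close> is an endomorphism of the Koszul complex, so a preimage under the
  differential of a cycle with values in \<open>M\<close> can be moved into \<open>M\<close> by \<open>Q\<close>. That boundaries are cycles is
  inherited from the whole space.\<close>

lemma taylor_nonsingular_restrict:
  fixes T :: "nat \<Rightarrow> 'a::chilbert_space \<Rightarrow> 'a" and Q :: "'a \<Rightarrow> 'a"
  assumes add: "\<And>x y. Q (x + y) = Q x + Q y" and scale: "\<And>r x. Q (r *\<^sub>R x) = r *\<^sub>R Q x"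
    and Q_in: "\<And>x. Q x \<in> M" and Q_id: "\<And>x. x \<in> M \<Longrightarrow> Q x = x"
    and comm: "\<And>i x. i \<in> {1..n} \<Longrightarrow> Q (T i x) = T i (Q x)"
    and ns: "taylor_nonsingular_on UNIV n T"
  shows "taylor_nonsingular_on M n T"
proof -
  interpret Q: additive Q by standard (rule add)
  have Q_diff: "(\<lambda>J. Q (koszul_diff n T w J)) = koszul_diff n T (\<lambda>J. Q (w J))" for w
  proof
    fix J
    show "Q (koszul_diff n T w J) = koszul_diff n T (\<lambda>J. Q (w J)) J"
      by (auto simp: koszul_diff_def Q.sum scale Q.zero comm intro!: sum.cong)
  qed
  have Q_mem: "(\<lambda>J. Q (w J)) \<in> koszul_space M n" if "w \<in> koszul_space UNIV n" for w
    using that by (auto simp: koszul_space_def Q_in Q.zero)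
  have Q_fix: "(\<lambda>J. Q (w J)) = w" if "w \<in> koszul_space M n" for w
    using that by (auto simp: koszul_space_def Q_id Q.zero fun_eq_iff split: if_splits)
      (metis Q.zero Q_id)
  have mono: "koszul_space M n \<subseteq> koszul_space UNIV n"
    by (auto simp: koszul_space_def split: if_splits)
  have eq: "{w \<in> koszul_space UNIV n. koszul_diff n T w = (\<lambda>_. 0)}
      = koszul_diff n T ` koszul_space UNIV n"
    using ns by (simp add: taylor_nonsingular_on_def)
  have "w \<in> koszul_diff n T ` koszul_space M n"
    if w: "w \<in> koszul_space M n" "koszul_diff n T w = (\<lambda>_. 0)" for w
  proof -
    obtain v where v: "v \<in> koszul_space UNIV n" "w = koszul_diff n T v"
      using eq w mono by blast
    have "w = koszul_diff n T (\<lambda>J. Q (v J))"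
      using Q_fix[OF w(1)] Q_diff[of v] v(2) by simp
    with Q_mem[OF v(1)] show ?thesis by blast
  qed
  moreover have "koszul_diff n T v \<in> koszul_space M n \<and> koszul_diff n T (koszul_diff n T v) = (\<lambda>_. 0)"
    if v: "v \<in> koszul_space M n" for v
  proof -
    have "koszul_diff n T v \<in> {w \<in> koszul_space UNIV n. koszul_diff n T w = (\<lambda>_. 0)}"
      using eq v mono by blast
    moreover have "koszul_diff n T v = (\<lambda>J. Q (koszul_diff n T v J))"
      using Q_diff[of v] Q_fix[OF v] by simp
    ultimately show ?thesis using Q_mem[of "koszul_diff n T v"] by auto
  qed
  ultimately show ?thesis unfolding taylor_nonsingular_on_def by blast
qed

lemma monom_op_commute:
  assumes comm: "\<And>i x. i \<in> {1..n} \<Longrightarrow> Q (T i x) = T i (Q x)"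
  shows "Q (monom_op n m T x) = monom_op n m T (Q x)"
proof -
  have pow: "Q ((T i ^^ k) y) = (T i ^^ k) (Q y)" if "i \<in> {1..n}" for i k y
    by (induction k) (simp_all add: comm[OF that])
  have "Q (foldr (\<lambda>i A. (T i ^^ Poly_Mapping.lookup m i) \<circ> A) is id x)
      = foldr (\<lambda>i A. (T i ^^ Poly_Mapping.lookup m i) \<circ> A) is id (Q x)"
    if "set is \<subseteq> {1..n}" for "is"
    using that by (induction "is") (simp_all add: pow)
  from this[of "[1..<Suc n]"] show ?thesis
    by (simp add: monom_op_def atLeastLessThanSuc_atLeastAtMost del: upt_Suc)
qed

lemma poly_op_commute:
  assumes add: "\<And>x y. Q (x + y) = Q x + Q y" and scale: "\<And>c x. Q (c *\<^sub>C x) = c *\<^sub>C Q x"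
    and comm: "\<And>i x. i \<in> {1..n} \<Longrightarrow> Q (T i x) = T i (Q x)"
  shows "Q (poly_op n p T x) = poly_op n p T (Q x)"
proof -
  interpret Q: additive Q by standard (rule add)
  have "Q (monom_op n m T x) = monom_op n m T (Q x)" for m
    by (rule monom_op_commute) (rule comm)
  then show ?thesis by (simp add: poly_op_def Q.sum scale)
qed

lemma bij_betw_restrict:
  assumes f: "bij f" and comm: "\<And>x. Q (f x) = f (Q x)"
    and Q_in: "\<And>x. Q x \<in> M" and Q_id: "\<And>x. x \<in> M \<Longrightarrow> Q x = x"
  shows "bij_betw f M M" and "y \<in> M \<Longrightarrow> inv_into M f y = inv f y"
proof -
  have "inj f" "surj f" using f by (auto simp: bij_def)
  have "f x \<in> M" if "x \<in> M" for x using comm[of x] Q_in[of "f x"] Q_id[OF that] by simp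
  moreover have ex: "\<exists>x\<in>M. y = f x" if "y \<in> M" for y
  proof -
    obtain x where "y = f x" using \<open>surj f\<close> by blast
    then have "y = f (Q x)" using comm[of x] Q_id[OF that] by simp
    then show ?thesis using Q_in by blast
  qed
  ultimately show "bij_betw f M M"
    using \<open>inj f\<close> unfolding bij_betw_def by (auto intro: inj_on_subset)
  assume "y \<in> M"
  then obtain x where "x \<in> M" "y = f x" using ex by blast
  then show "inv_into M f y = inv f y"
    using \<open>inj f\<close> by (simp add: inv_into_f_f inj_on_subset)
qed

text \<open>The projection onto \<open>M\<close> commutes with the tuple, hence with \<open>q(T)\<close>. So \<open>q(T)\<close> is also
  invertible on \<open>M\<close>, with inverse the restriction of the inverse on the whole space, and the norm
  inequality on \<open>M\<close> is an instance of the one on the whole space.\<close>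

theorem gamma_contraction_restrict:
  assumes G: "gamma_contraction_on UNIV n S P" and M: "closed_csubspace M"
    and inv: "\<And>i. i \<in> {1..n} \<Longrightarrow> (S(n := P)) i ` M \<subseteq> M"
      "\<And>i. i \<in> {1..n} \<Longrightarrow> (S(n := P)) i ` ortho_compl M \<subseteq> ortho_compl M"
  shows "gamma_contraction_on M n S P"
proof -
  define T where "T = S(n := P)"
  define Q where "Q = ortho_proj M"
  have T: "bounded_op_on UNIV (T i)" if "i \<in> {1..n}" for i
    using G that by (auto simp: gamma_contraction_on_def commuting_tuple_on_def T_def)
  have comm: "Q (T i x) = T i (Q x)" if "i \<in> {1..n}" for i x
    unfolding Q_def T_def
    using T[OF that] M inv[OF that] by (intro ortho_proj_commute) (simp_all add: T_def)
  have add: "Q (x + y) = Q x + Q y" for x y by (simp add: Q_def ortho_proj_add[OF M])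
  have scale: "Q (c *\<^sub>C x) = c *\<^sub>C Q x" for c x by (simp add: Q_def ortho_proj_scaleC[OF M])
  have scaleR: "Q (r *\<^sub>R x) = r *\<^sub>R Q x" for r x
    using scale[of "of_real r" x] by (simp add: scaleC_of_real)
  have Q_in: "Q x \<in> M" for x by (simp add: Q_def ortho_proj_in[OF M])
  have Q_id: "Q x = x" if "x \<in> M" for x using that by (simp add: Q_def ortho_proj_id[OF M])
  interpret Q: additive Q by standard (rule add)
  have spec: "spectral_set_on UNIV n T (Gamma_set n)"
    using G by (simp add: gamma_contraction_on_def T_def)
  have "bounded_op_on M (T i)" if "i \<in> {1..n}" for i
    using T[OF that] inv(1)[OF that, folded T_def] unfolding bounded_op_on_def by blast
  then have tuple: "commuting_tuple_on M n T"
    using G unfolding gamma_contraction_on_def commuting_tuple_on_def T_def by auto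
  have "taylor_spectrum_on M n T \<subseteq> taylor_spectrum_on UNIV n T"
  proof -
    have "taylor_nonsingular_on M n (\<lambda>i x. T i x - l i *\<^sub>C x)"
      if "taylor_nonsingular_on UNIV n (\<lambda>i x. T i x - l i *\<^sub>C x)" for l
      by (rule taylor_nonsingular_restrict[where Q = Q])
        (use add scaleR Q_in Q_id that in \<open>auto simp: Q.diff comm scale\<close>)
    then show ?thesis unfolding taylor_spectrum_on_def by blast
  qed
  moreover have "bij_betw (poly_op n q T) M M"
      "y \<in> M \<Longrightarrow> inv_into M (poly_op n q T) y = inv (poly_op n q T) y"
    if "bij (poly_op n q T)" for q y
  proof -
    have "Q (poly_op n q T x) = poly_op n q T (Q x)" for x
      by (rule poly_op_commute) (use add scale comm in auto)
    from bij_betw_restrict[where Q = Q and M = M, OF that this Q_in Q_id]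
    show "bij_betw (poly_op n q T) M M"
      "y \<in> M \<Longrightarrow> inv_into M (poly_op n q T) y = inv (poly_op n q T) y" by auto
  qed
  ultimately have "spectral_set_on M n T (Gamma_set n)"
    using spec unfolding spectral_set_on_def by auto
  with tuple show ?thesis using M by (simp add: gamma_contraction_on_def T_def)
qed

section \<open>The fixed space of a contraction\<close>

lemma sym_map_last:
  assumes "n \<ge> 1"
  shows "sym_map n z n = (\<Prod>j\<in>{1..n}. z j)"
proof -
  have "{J. J \<subseteq> {1..n} \<and> card J = n} = {{1..n}}"
    using card_subset_eq[of "{1..n}"] by auto
  with assms show ?thesis by (simp add: sym_map_def)
qed

lemma poly_op_one: "poly_op n (Poly_Mapping.single 0 1) T x = x"
proof -
  have "foldr (\<lambda>i A. (T i ^^ Poly_Mapping.lookup 0 i) \<circ> A) is id x = x" for "is"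
    by (induction "is") simp_all
  then have "monom_op n 0 T x = x" unfolding monom_op_def .
  then show ?thesis using scaleC_of_real[of 1 x] by (simp add: poly_op_def)
qed

lemma poly_op_last:
  assumes "n \<ge> 1"
  shows "poly_op n (Poly_Mapping.single (Poly_Mapping.single n 1) 1) T x = T n x"
proof -
  have "foldr (\<lambda>i A. (T i ^^ Poly_Mapping.lookup (Poly_Mapping.single n 1) i) \<circ> A) is B x = B x"
    if "n \<notin> set is" for "is" B
    using that by (induction "is") (auto simp: lookup_single when_def)
  from this[of "[1..<n]"] have "monom_op n (Poly_Mapping.single n 1) T x = T n x"
    using assms by (simp add: monom_op_def)
  then show ?thesis using scaleC_of_real[of 1 "T n x"] by (simp add: poly_op_def)
qed

lemma gamma_contraction_norm_le:
  assumes n: "n \<ge> 1" and G: "gamma_contraction_on UNIV n S P"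
  shows "norm (P x) \<le> norm x"
proof -
  define p :: cpoly where "p = Poly_Mapping.single (Poly_Mapping.single n 1) 1"
  define q :: cpoly where "q = Poly_Mapping.single 0 1"
  have pq: "p \<in> cpolys n" "q \<in> cpolys n"
    using n by (auto simp: p_def q_def cpolys_def)
  have q: "poly_eval n q z = 1" for z by (simp add: q_def poly_eval_def)
  have p: "poly_eval n p z = z n" for z
  proof -
    have "(\<Prod>i\<in>{1..n}. z i ^ Poly_Mapping.lookup (Poly_Mapping.single n 1) i)
        = (\<Prod>i\<in>{1..n}. if i = n then z n else 1)"
      by (rule prod.cong) (auto simp: lookup_single when_def)
    then show ?thesis using n by (simp add: p_def poly_eval_def)
  qed
  have "poly_op n q (S(n := P)) = id"
    unfolding q_def by (rule ext) (simp only: poly_op_one id_apply)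
  moreover have "poly_op n p (S(n := P)) x = P x"
    using poly_op_last[OF n, of "S(n := P)"] by (simp add: p_def)
  moreover have "norm (poly_op n p (S(n := P)) (inv_into UNIV (poly_op n q (S(n := P))) x))
      \<le> (SUP z\<in>Gamma_set n. cmod (poly_eval n p z / poly_eval n q z)) * norm x"
  proof -
    have "\<forall>z\<in>Gamma_set n. poly_eval n q z \<noteq> 0" by (simp add: q)
    with G pq show ?thesis unfolding gamma_contraction_on_def spectral_set_on_def by blast
  qed
  ultimately have "norm (P x) \<le> (SUP z\<in>Gamma_set n. cmod (z n)) * norm x"
    by (simp add: p q)
  also have "(SUP z\<in>Gamma_set n. cmod (z n)) \<le> 1"
  proof (rule cSUP_least)
    have "(\<lambda>_. 0) \<in> {z \<in> cspace n. \<forall>i\<in>{1..n}. cmod (z i) \<le> 1}" by (simp add: cspace_def)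
    then show "Gamma_set n \<noteq> {}" unfolding Gamma_set_def by blast
    show "cmod (z n) \<le> 1" if "z \<in> Gamma_set n" for z
      using that n by (auto simp: Gamma_set_def sym_map_last prod_norm[symmetric] intro!: prod_le_1)
  qed
  finally show ?thesis by (simp add: mult_right_mono)
qed

text \<open>If \<open>P x = x\<close>, compare the squares of the norms of \<open>x + t y\<close> and of its image
  \<open>x + t P y\<close>: the term linear in \<open>t\<close> is governed by the inner product of \<open>x\<close> with
  \<open>y - P y\<close>, which therefore vanishes. Conversely, if \<open>x\<close> is orthogonal to \<open>x - P x\<close>, then
  the square of the norm of \<open>x - P x\<close> is the difference of the squares of those of \<open>P x\<close>
  and \<open>x\<close>, so it is not positive.\<close>

lemma contraction_fixed_space:
  assumes P: "bounded_op_on UNIV P" and contr: "\<And>x. norm (P x) \<le> norm x"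
  shows "ortho_compl (closure (range (\<lambda>x. x - P x))) = {x. x - P x = 0}"
proof (intro equalityI subsetI)
  fix x assume "x \<in> ortho_compl (closure (range (\<lambda>x. x - P x)))"
  then have "cinner x (x - P x) = 0"
    using closure_subset[of "range (\<lambda>x. x - P x)"] by (auto simp: ortho_compl_def)
  then have "Re (cinner x (P x)) = (norm x)\<^sup>2"
    using cinner_self[of x] by (metis Re_complex_of_real cinner_diff_right eq_iff_diff_eq_0)
  then have "(norm (x - P x))\<^sup>2 = (norm (P x))\<^sup>2 - (norm x)\<^sup>2"
    by (simp add: norm_diff_square)
  also have "\<dots> \<le> 0" using power_mono[OF contr[of x] norm_ge_zero, of 2] by simp
  finally show "x \<in> {x. x - P x = 0}" by simp
next
  fix x assume "x \<in> {x. x - P x = 0}"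
  then have x: "P x = x" by simp
  have ran: "cinner x (y - P y) = 0" for y
  proof -
    have "cinner x (P y - y) = 0"
    proof (rule first_order_condition)
      fix t
      have "norm (x + t *\<^sub>C P y) \<le> norm (x + t *\<^sub>C y)"
        using contr[of "x + t *\<^sub>C y"] by (simp add: bounded_op_add[OF P] bounded_op_scaleC[OF P] x)
      then have "(norm (x + t *\<^sub>C P y))\<^sup>2 \<le> (norm (x + t *\<^sub>C y))\<^sup>2"
        by (intro power_mono) simp_all
      then show "2 * Re (cnj t * cinner x (P y - y)) \<le> (cmod t)\<^sup>2 * ((norm y)\<^sup>2 - (norm (P y))\<^sup>2)"
        by (simp add: norm_add_square cinner_scaleC_right norm_scaleC cinner_diff_right
            power_mult_distrib right_diff_distrib)
    qed
    then show ?thesis by (simp add: cinner_diff_right)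
  qed
  have "range (\<lambda>x. x - P x) \<subseteq> ortho_compl {x}"
    using ran cinner_eq_0_commute unfolding ortho_compl_def by blast
  then have "closure (range (\<lambda>x. x - P x)) \<subseteq> ortho_compl {x}"
    by (intro closure_minimal closed_csubspace_closed closed_csubspace_ortho_compl)
  then show "x \<in> ortho_compl (closure (range (\<lambda>x. x - P x)))"
    using cinner_eq_0_commute unfolding ortho_compl_def by blast
qed

lemma closed_csubspace_closure_range:
  assumes A: "bounded_op_on UNIV A"
  shows "closed_csubspace (closure (range (\<lambda>x. x - A x)))"
proof -
  let ?R = "range (\<lambda>x. x - A x)"
  have "x + y \<in> closure ?R" if xy: "x \<in> closure ?R" "y \<in> closure ?R" for x y
  proof -
    obtain f g where fg: "\<And>k. f k \<in> ?R" "f \<longlonglongrightarrow> x" "\<And>k. g k \<in> ?R" "g \<longlonglongrightarrow> y"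
      using xy unfolding closure_sequential by blast
    have "f k + g k \<in> ?R" for k
    proof -
      obtain a b where "f k = a - A a" "g k = b - A b" using fg(1,3) by blast
      then have "f k + g k = (a + b) - A (a + b)" by (simp add: bounded_op_add[OF A])
      then show ?thesis by blast
    qed
    then show ?thesis
      unfolding closure_sequential using tendsto_add[OF fg(2,4)]
      by (intro exI[of _ "\<lambda>k. f k + g k"] conjI allI)
  qed
  moreover have "c *\<^sub>C x \<in> closure ?R" if x: "x \<in> closure ?R" for c x
  proof -
    have "(\<lambda>x. c *\<^sub>C x) ` closure ?R \<subseteq> closure ((\<lambda>x. c *\<^sub>C x) ` ?R)"
      by (intro closure_bounded_linear_image_subset bounded_op_bounded_linear
          bounded_op_scaleC_map)
    also have "(\<lambda>x. c *\<^sub>C x) ` ?R \<subseteq> ?R"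
    proof
      fix y assume "y \<in> (\<lambda>x. c *\<^sub>C x) ` ?R"
      then obtain a where "y = c *\<^sub>C (a - A a)" by blast
      also have "a - A a = a + (-1) *\<^sub>C A a" by (simp add: scaleC_minus_one)
      also have "c *\<^sub>C \<dots> = c *\<^sub>C a - A (c *\<^sub>C a)"
        by (simp add: scaleC_add_right scaleC_scaleC bounded_op_scaleC[OF A])
          (metis mult_minus1 scaleC_minus_one scaleC_scaleC diff_conv_add_uminus)
      finally show "y \<in> ?R" by blast
    qed
    then have "closure ((\<lambda>x. c *\<^sub>C x) ` ?R) \<subseteq> closure ?R" by (rule closure_mono)
    finally show ?thesis using x by blast
  qed
  moreover have "0 \<in> ?R" using bounded_op_0[OF A] by (metis diff_zero rangeI)
  then have "0 \<in> closure ?R" by (rule subsetD[OF closure_subset])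
  ultimately show ?thesis unfolding closed_csubspace_def by blast
qed

lemma commuting_op_invariant:
  assumes A: "bounded_op_on UNIV A" and comm: "\<And>x. A (P x) = P (A x)"
  shows "A ` closure (range (\<lambda>x. x - P x)) \<subseteq> closure (range (\<lambda>x. x - P x))"
    and "A ` {x. x - P x = 0} \<subseteq> {x. x - P x = 0}"
proof -
  have "A ` closure (range (\<lambda>x. x - P x)) \<subseteq> closure (A ` range (\<lambda>x. x - P x))"
    by (rule closure_bounded_linear_image_subset[OF bounded_op_bounded_linear[OF A]])
  also have "\<dots> \<subseteq> closure (range (\<lambda>x. x - P x))"
    by (rule closure_mono) (auto simp: bounded_op_diff[OF A] comm)
  finally show "A ` closure (range (\<lambda>x. x - P x)) \<subseteq> closure (range (\<lambda>x. x - P x))" .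
  show "A ` {x. x - P x = 0} \<subseteq> {x. x - P x = 0}"
    by (auto simp flip: comm)
qed

section \<open>The canonical decomposition\<close>

theorem theorem4p8:
  fixes n :: nat
    and S :: "nat \<Rightarrow> 'a::chilbert_space \<Rightarrow> 'a"
    and P :: "'a \<Rightarrow> 'a"
  assumes "n \<ge> 2"
    and "gamma_contraction_on UNIV n S P"
  shows "(\<forall>i\<in>{1..n-1}. reduces_on UNIV (closure (range (\<lambda>x. x - P x))) (S i) \<and>
                       reduces_on UNIV {x. x - P x = 0} (S i)) \<and>
         gamma_identity_on {x. x - P x = 0} n S P \<and>
         cni_gamma_contraction_on (closure (range (\<lambda>x. x - P x))) n S P"
proof -
  define T where "T = S(n := P)"
  define R where "R = closure (range (\<lambda>x. x - P x))"
  define N where "N = {x. x - P x = 0}"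
  have n: "n \<in> {1..n}" using assms(1) by simp
  have Tn: "T n = P" by (simp add: T_def)
  have tuple: "commuting_tuple_on UNIV n T"
    using assms(2) by (simp add: gamma_contraction_on_def T_def)
  then have bT: "bounded_op_on UNIV (T i)" if "i \<in> {1..n}" for i
    using that by (simp add: commuting_tuple_on_def)
  have comm: "T i (P x) = P (T i x)" if "i \<in> {1..n}" for i x
    using tuple that n unfolding commuting_tuple_on_def Tn[symmetric] by blast
  have bP: "bounded_op_on UNIV P" using bT[OF n] by (simp add: Tn)
  have R: "closed_csubspace R"
    unfolding R_def using bP by (rule closed_csubspace_closure_range)
  have compl_R: "ortho_compl R = N"
    unfolding R_def N_def using bP gamma_contraction_norm_le[OF _ assms(2)] assms(1)
    by (intro contraction_fixed_space) auto
  then have N: "closed_csubspace N" using closed_csubspace_ortho_compl by metis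
  have compl_N: "ortho_compl N = R" using ortho_compl_ortho_compl[OF R] compl_R by simp
  have inv: "T i ` R \<subseteq> R" "T i ` N \<subseteq> N" if "i \<in> {1..n}" for i
    unfolding R_def N_def
    by (rule commuting_op_invariant[OF bT[OF that]], rule comm[OF that])+
  have "reduces_on UNIV R (S i) \<and> reduces_on UNIV N (S i)" if "i \<in> {1..n-1}" for i
  proof -
    from that assms(1) have i: "i \<in> {1..n}" "T i = S i" by (auto simp: T_def)
    show ?thesis
      using reduces_if_complement_invariant[OF bT[OF i(1)]] R N inv[OF i(1)] compl_R compl_N
      by (simp add: i(2))
  qed
  moreover have "gamma_identity_on N n S P"
    unfolding gamma_identity_on_def
    using gamma_contraction_restrict[OF assms(2) N] inv compl_N by (auto simp: T_def N_def)
  moreover have "cni_gamma_contraction_on R n S P"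
  proof -
    have "L = {0}" if L: "reduces_on R L P" "\<forall>x\<in>L. P x = x" for L
    proof -
      have "0 \<in> L" "L \<subseteq> R" using L(1) by (auto simp: reduces_on_def closed_csubspace_0)
      moreover have "L \<subseteq> ortho_compl R" using L(2) by (auto simp: compl_R N_def)
      ultimately show ?thesis using ortho_compl_Int by blast
    qed
    moreover have "gamma_contraction_on R n S P"
      using gamma_contraction_restrict[OF assms(2) R] inv compl_R by (auto simp: T_def)
    ultimately show ?thesis unfolding cni_gamma_contraction_on_def by blast
  qed
  ultimately show ?thesis by (simp add: R_def N_def)
qed

end
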